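(* Let $n\in\mathbb{N}$. The coefficients of $p_n(x)$ satisfy $c_{n,2^{n+1}}=1$ and, for every $j\in\{1,2,\dots,2^n\}$, $$c_{n,2(2^n-j)}=-\sum_{i=2^n-j+1}^{2^n}\binom{2i}{j+i-2^n}\,c_{n,2i}.$$ (Thus the coefficients $c_{n,2(2^n-j)}$ are determined recursively in $j$ from $0$ to $2^n$.)
   Context: The polynomials $p_n(x)\in\mathbb{Z}[x]$ are defined by $p_0(x)=x^2-2$ and $p_n(x)=p_{n-1}(x)^2-2$ for $n\ge1$. For $n,k\in\mathbb{N}$, $c_{n,k}$ denotes the coefficient of $x^k$ in $p_n(x)$. *)

theory Defs
  imports "HOL-Computational_Algebra.Polynomial"
begin

fun p :: "nat \<Rightarrow> int poly" where
  "p 0 = [:-2, 0, 1:]"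
| "p (Suc n) = (p n)\<^sup>2 - [:2:]"

definition c :: "nat \<Rightarrow> nat \<Rightarrow> int" where
  "c n k = coeff (p n) k"

end

theory Submission
  imports Defs "HOL-Computational_Algebra.Formal_Laurent_Series"
begin

text \<open>If \<open>x * y = 1\<close> then \<open>(x^k + y^k)^2 - 2 = x^(2k) + y^(2k)\<close>, so with \<open>N = 2^n\<close> the
  polynomial \<open>p n\<close> takes the value \<open>X^(2N) + X^(-2N)\<close> at the Laurent polynomial \<open>X + X^(-1)\<close>.
  The recursion compares the coefficients of \<open>X^(2(N - j))\<close> on both sides; by parity, the odd
  powers of \<open>X + X^(-1)\<close> contribute nothing to them.\<close>

unbundle fps_syntax

lemma sum_atMost_even:
  fixes g :: "nat \<Rightarrow> 'a::comm_monoid_add"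
  assumes "\<And>m. odd m \<Longrightarrow> g m = 0"
  shows "(\<Sum>m\<le>2 * d. g m) = (\<Sum>i\<le>d. g (2 * i))"
  by (induction d) (simp_all add: assms)

lemma map_poly_of_int_diff:
  "map_poly of_int (f - g) = map_poly of_int f - (map_poly of_int g :: 'a::ring_1 poly)"
  by (simp add: poly_eq_iff coeff_map_poly)

lemma map_poly_of_int_mult:
  "map_poly of_int (f * g) = map_poly of_int f * (map_poly of_int g :: 'a::comm_ring_1 poly)"
  by (simp add: poly_eq_iff coeff_map_poly coeff_mult)

lemma poly_p_add_inverse:
  fixes x y :: "'a::comm_ring_1"
  assumes "x * y = 1"
  shows "poly (map_poly of_int (p n)) (x + y) = x ^ 2 ^ (n + 1) + y ^ 2 ^ (n + 1)"
proof (induction n)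
  case 0
  have "poly (map_poly of_int (p 0)) (x + y) = (x + y)\<^sup>2 - 2"
    by (simp add: map_poly_pCons power2_eq_square)
  also have "\<dots> = x ^ 2 ^ (0 + 1) + y ^ 2 ^ (0 + 1)"
    using assms by (simp add: power2_sum mult.assoc)
  finally show ?case .
next
  case (Suc n)
  let ?M = "2 ^ (n + 1) :: nat"
  have "poly (map_poly of_int (p (Suc n))) (x + y) = (x ^ ?M + y ^ ?M)\<^sup>2 - 2"
    using Suc.IH
    by (simp add: map_poly_of_int_diff map_poly_of_int_mult map_poly_pCons power2_eq_square)
  also have "\<dots> = (x ^ ?M)\<^sup>2 + (y ^ ?M)\<^sup>2"
    using assms by (simp add: power2_sum mult.assoc flip: power_mult_distrib)
  also have "\<dots> = x ^ 2 ^ (Suc n + 1) + y ^ 2 ^ (Suc n + 1)"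
    by (simp add: mult.commute flip: power_mult)
  finally show ?case .
qed

lemma degree_p_le: "degree (p n) \<le> 2 * 2 ^ n"
proof (induction n)
  case (Suc n)
  have "degree ((p n)\<^sup>2) \<le> 2 * 2 ^ Suc n"
    using degree_power_le[of "p n" 2] Suc.IH by simp
  then show ?case
    by (simp add: degree_diff_le)
qed simp

lemma fls_X_plus_X_inv_power:
  "(fls_X + fls_X_inv) ^ m
    = (\<Sum>l\<le>m. of_nat (m choose l) * fls_X_intpow (2 * int l - int m) :: 'a::comm_semiring_1 fls)"
  unfolding binomial_ring
proof (rule sum.cong)
  fix l assume "l \<in> {..m}"
  then have "(fls_X ^ l * fls_X_inv ^ (m - l) :: 'a fls) = fls_X_intpow (2 * int l - int m)"
    by (simp add: fls_X_power_times_conv_shift fls_X_inv_power_conv_shift_1 of_nat_diff)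
  then show "of_nat (m choose l) * fls_X ^ l * fls_X_inv ^ (m - l)
      = (of_nat (m choose l) * fls_X_intpow (2 * int l - int m) :: 'a fls)"
    by (simp add: mult.assoc)
qed simp

lemma fls_X_plus_X_inv_power_nth:
  "(fls_X + fls_X_inv) ^ m $$ (2 * int l - int m) = (of_nat (m choose l) :: 'a::comm_semiring_1)"
proof -
  have "(fls_X + fls_X_inv) ^ m $$ (2 * int l - int m)
      = (\<Sum>i\<le>m. if i = l then of_nat (m choose i) else 0 :: 'a)"
    unfolding fls_X_plus_X_inv_power fls_nth_sum by (rule sum.cong) auto
  also have "\<dots> = of_nat (m choose l)"
    by (simp add: binomial_eq_0)
  finally show ?thesis .
qed

lemma fls_X_plus_X_inv_power_nth_odd:
  assumes "odd (k + int m)"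
  shows "(fls_X + fls_X_inv) ^ m $$ k = (0 :: 'a::comm_semiring_1)"
proof -
  have "k + (int m - 2 * int l) \<noteq> 0" for l
    using assms by presburger
  then show ?thesis
    by (simp add: fls_X_plus_X_inv_power fls_nth_sum)
qed

lemma poly_X_plus_X_inv_nth_even:
  fixes f :: "int poly"
  assumes "degree f \<le> 2 * d"
  shows "poly (map_poly of_int f) (fls_X + fls_X_inv) $$ (2 * int a)
    = (\<Sum>i\<le>d. of_nat (2 * i choose (i + a)) * of_int (coeff f (2 * i)) :: 'a::comm_ring_1)"
proof -
  let ?z = "fls_X + fls_X_inv :: 'a fls"
  let ?f = "map_poly of_int f :: 'a fls poly"
  have "degree ?f \<le> 2 * d"
    using map_poly_degree_leq assms by (rule order_trans)
  then have "poly ?f ?z = (\<Sum>m\<le>2 * d. coeff ?f m * ?z ^ m)"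
    unfolding poly_altdef by (intro sum.mono_neutral_left) (auto simp: coeff_eq_0)
  then have "poly ?f ?z $$ (2 * int a) = (\<Sum>m\<le>2 * d. of_int (coeff f m) * ?z ^ m $$ (2 * int a))"
    by (simp add: coeff_map_poly fls_nth_sum)
  also have "\<dots> = (\<Sum>i\<le>d. of_int (coeff f (2 * i)) * ?z ^ (2 * i) $$ (2 * int a))"
    by (rule sum_atMost_even) (simp add: fls_X_plus_X_inv_power_nth_odd)
  also have "\<dots> = (\<Sum>i\<le>d. of_nat (2 * i choose (i + a)) * of_int (coeff f (2 * i)))"
    using fls_X_plus_X_inv_power_nth[of "2 * i" "i + a" for i, where 'a='a]
    by (simp add: mult.commute)
  finally show ?thesis .
qed

lemma sum_binomial_mult_c:
  "(\<Sum>i = a..2 ^ n. int (2 * i choose (i - a)) * c n (2 * i)) = (if a = 2 ^ n then 1 else 0)"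
proof -
  have choose_sym: "2 * i choose (i - a) = 2 * i choose (i + a)" if "a \<le> i" for i
    using that binomial_symmetric[of "i - a" "2 * i"] by simp
  have "(\<Sum>i = a..2 ^ n. int (2 * i choose (i - a)) * c n (2 * i))
      = (\<Sum>i\<le>2 ^ n. int (2 * i choose (i + a)) * c n (2 * i))"
    by (rule sum.mono_neutral_cong_left) (auto simp: choose_sym binomial_eq_0)
  also have "\<dots> = poly (map_poly of_int (p n)) (fls_X + fls_X_inv) $$ (2 * int a)"
    by (simp add: poly_X_plus_X_inv_nth_even[OF degree_p_le] c_def)
  also have "\<dots> = (fls_X ^ 2 ^ (n + 1) + fls_X_inv ^ 2 ^ (n + 1)) $$ (2 * int a)"
    by (simp add: poly_p_add_inverse fls_X_times_conv_shift)
  also have "\<dots> = (if a = 2 ^ n then 1 else 0)"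
  proof -
    have "- (2 ^ n) < int a"
      by (rule less_le_trans[of _ 0]) simp_all
    then show ?thesis
      by auto
  qed
  finally show ?thesis .
qed

theorem theorem2p1:
  fixes n :: nat
  shows "c n (2 ^ (n + 1)) = 1 \<and>
    (\<forall>j\<in>{1..2 ^ n}.
      c n (2 * (2 ^ n - j)) =
        - (\<Sum>i = 2 ^ n - j + 1..2 ^ n. int ((2 * i) choose (j + i - 2 ^ n)) * c n (2 * i)))"
proof (intro conjI ballI)
  show "c n (2 ^ (n + 1)) = 1"
    using sum_binomial_mult_c[of "2 ^ n" n] by simp
next
  fix j :: nat assume j: "j \<in> {1..2 ^ n}"
  then have "i - (2 ^ n - j) = j + i - 2 ^ n" for i
    by simp
  then have "(\<Sum>i = 2 ^ n - j..2 ^ n. int (2 * i choose (j + i - 2 ^ n)) * c n (2 * i)) = 0"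
    using sum_binomial_mult_c[of "2 ^ n - j" n] j by auto
  then show "c n (2 * (2 ^ n - j)) =
      - (\<Sum>i = 2 ^ n - j + 1..2 ^ n. int ((2 * i) choose (j + i - 2 ^ n)) * c n (2 * i))"
    using j by (simp add: sum.atLeast_Suc_atMost)
qed

end
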